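(* Let $\mathcal F$ and $\mathcal G$ be MaxSAT formulas, each possibly containing both soft and hard clauses. Let $\gamma$ be a real number with $\gamma > \max_{X \,:\, \mathcal F(X)<\infty} \mathcal F(X)$, where, if $\mathcal F(X)=\infty$ for every truth assignment $X$, $\gamma$ is any real number $\gamma>0$. Let $\mathcal G^{\gamma}$ be the formula obtained from $\mathcal G$ by replacing every weight $\infty$ by $\gamma$. Then $$\mathcal F \models \mathcal G \iff \mathrm{MaxSAT}\big(\mathcal F \cup \overline{\mathcal G^{\gamma}}\big) \ge \mathit{rf}(\mathcal G^{\gamma}).$$
   Context: A literal is a Boolean variable $x$ or its negation $\overline x$; a clause is a disjunction of literals, and $\Box$ is the empty clause (satisfied by no assignment). A truth assignment satisfies a clause if it makes at least one of its literals true. A weight is an element of $\mathbb{R}_{>0}\cup\{\infty\}$ with $\infty+w=\infty$ and $\infty-w=\infty$. A weighted clause is a pair $(C,w)$; it is hard if $w=\infty$ and soft otherwise. A MaxSAT formula is a finite collection of weighted clauses, where $(C,u),(C,v)$ may be merged into $(C,u+v)$ and conversely. The cost $\mathcal F(X)$ of a truth assignment $X$ is the sum of the weights of the clauses of $\mathcal F$ falsified by $X$; $\mathrm{MaxSAT}(\mathcal F)=\min_X \mathcal F(X)$. $\mathcal F\models\mathcal G$ means $\mathcal F(X)\ge\mathcal G(X)$ for every truth assignment $X$. The roof is $\mathit{rf}(\mathcal F)=\sum_{(C,w)\in\mathcal F} w$. For a clause $C=l_1\lor\dots\lor l_p$, the weighted negated clause $(\overline C,w)$ (which costs $w$ exactly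 on assignments satisfying $C$) is represented in CNF as the clauses $(\overline{l_1},w),(l_1\lor\overline{l_2},w),\dots,(l_1\lor\dots\lor l_{p-1}\lor\overline{l_p},w)$. The negation of a formula is $\overline{\mathcal F}=\{(\overline C,w)\mid (C,w)\in\mathcal F\}$ (in this CNF representation). *)

theory Defs
  imports "HOL-Library.Multiset" "HOL-Library.Extended_Nonnegative_Real"
begin

datatype 'v literal = Pos 'v | Neg 'v

fun negate :: "'v literal \<Rightarrow> 'v literal" where
  "negate (Pos x) = Neg x"
| "negate (Neg x) = Pos x"

fun lit_true :: "('v \<Rightarrow> bool) \<Rightarrow> 'v literal \<Rightarrow> bool" where
  "lit_true X (Pos x) \<longleftrightarrow> X x"
| "lit_true X (Neg x) \<longleftrightarrow> \<not> X x"

text \<open>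
  A clause \<open>l\<^sub>1 \<or> \<dots> \<or> l\<^sub>p\<close> is the list \<open>[l\<^sub>1, \<dots>, l\<^sub>p]\<close>, since the CNF representation of its
  negation depends on the order of the literals; the empty list is the empty clause.
\<close>

type_synonym 'v clause = "'v literal list"

definition satisfies :: "('v \<Rightarrow> bool) \<Rightarrow> 'v clause \<Rightarrow> bool" where
  "satisfies X C \<longleftrightarrow> (\<exists>l \<in> set C. lit_true X l)"

text \<open>
  Formulas are multisets, as weights of repeated clauses add up; the union of two formulas is
  accordingly the multiset sum.
\<close>

type_synonym 'v wformula = "('v clause \<times> ennreal) multiset"

definition maxsat_formula :: "'v wformula \<Rightarrow> bool" where
  "maxsat_formula F \<longleftrightarrow> (\<forall>(C, w) \<in># F. 0 < w)"

definition cost :: "'v wformula \<Rightarrow> ('v \<Rightarrow> bool) \<Rightarrow> ennreal" where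
  "cost F X = (\<Sum>(C, w) \<in># filter_mset (\<lambda>(C, w). \<not> satisfies X C) F. w)"

text \<open>
  Even if there are infinitely many assignments, the cost takes only finitely many values
  (lemma \<open>finite_range_cost\<close> below), so this minimum and the maximum of the finite costs are well defined.
\<close>

definition MaxSAT :: "'v wformula \<Rightarrow> ennreal" where
  "MaxSAT F = Min (range (cost F))"

definition entails :: "'v wformula \<Rightarrow> 'v wformula \<Rightarrow> bool" where
  "entails F G \<longleftrightarrow> (\<forall>X. cost F X \<ge> cost G X)"

definition roof :: "'v wformula \<Rightarrow> ennreal" where
  "roof F = (\<Sum>(C, w) \<in># F. w)"

definition neg_clause :: "'v clause \<Rightarrow> ennreal \<Rightarrow> 'v wformula" where
  "neg_clause C w = mset (map (\<lambda>i. (take i C @ [negate (C ! i)], w)) [0..<length C])"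

definition neg_formula :: "'v wformula \<Rightarrow> 'v wformula" where
  "neg_formula F = (\<Sum>(C, w) \<in># F. neg_clause C w)"

definition soften :: "real \<Rightarrow> 'v wformula \<Rightarrow> 'v wformula" where
  "soften \<gamma> G = image_mset (\<lambda>(C, w). (C, if w = \<infinity> then ennreal \<gamma> else w)) G"

lemma finite_range_cost: "finite (range (cost F))"
proof (induction F)
  case empty
  show ?case by (simp add: cost_def)
next
  case (add p F)
  have "cost (add_mset p F) X = cost F X \<or> cost (add_mset p F) X = snd p + cost F X" for X
    by (cases p) (simp add: cost_def)
  then have "range (cost (add_mset p F)) \<subseteq> range (cost F) \<union> (+) (snd p) ` range (cost F)"
    by (auto simp: image_iff)
  then show ?case
    using add.IH by (auto intro: finite_subset)
qed

lemma lit_true_negate [simp]: "lit_true X (negate l) \<longleftrightarrow> \<not> lit_true X l"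
  by (cases l) auto

lemma neg_clause_snoc:
  "neg_clause (C @ [l]) w = neg_clause C w + {#(C @ [negate l], w)#}"
  by (auto simp: neg_clause_def nth_append intro!: image_mset_cong)

lemma cost_neg_clause: "cost (neg_clause C w) X = (if satisfies X C then w else 0)"
proof (induction C rule: rev_induct)
  case Nil
  show ?case by (simp add: neg_clause_def cost_def satisfies_def)
next
  case (snoc l C)
  have "cost (neg_clause (C @ [l]) w) X =
      cost (neg_clause C w) X + (if satisfies X (C @ [negate l]) then 0 else w)"
    by (simp add: neg_clause_snoc cost_def)
  also have "\<dots> = (if satisfies X (C @ [l]) then w else 0)"
    unfolding snoc.IH by (auto simp: satisfies_def)
  finally show ?case .
qed

end

theory Submission
  imports Defs
begin

text \<open>
  Every assignment \<open>X\<close> splits the roof of \<open>\<G>\<^sup>\<gamma>\<close> into the cost of \<open>\<G>\<^sup>\<gamma>\<close> and the cost of its negation.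
  All these quantities are finite, so the right-hand side amounts to \<open>\<F>(X) \<ge> \<G>\<^sup>\<gamma>(X)\<close> for all \<open>X\<close>.
  Softening changes the cost only where \<open>\<G>(X) = \<infinity>\<close>, and there \<open>\<G>\<^sup>\<gamma>(X) \<ge> \<gamma>\<close> still
  exceeds every finite cost of \<open>\<F>\<close>.
\<close>

lemma cost_empty [simp]: "cost {#} X = 0"
  by (simp add: cost_def)

lemma cost_add_mset [simp]:
  "cost (add_mset (C, w) F) X = (if satisfies X C then 0 else w) + cost F X"
  by (simp add: cost_def)

lemma cost_union [simp]: "cost (F + G) X = cost F X + cost G X"
  by (simp add: cost_def)

text \<open>Each clause contributes its weight to exactly one of the two costs, depending on whether
  \<open>X\<close> satisfies it.\<close>

lemma cost_add_cost_neg_formula: "cost F X + cost (neg_formula F) X = roof F"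
proof (induction F)
  case empty
  show ?case by (simp add: neg_formula_def roof_def)
next
  case (add p F)
  obtain C w where p: "p = (C, w)" by force
  have "cost (add_mset p F) X + cost (neg_formula (add_mset p F)) X
      = w + (cost F X + cost (neg_formula F) X)"
    by (simp add: p neg_formula_def cost_neg_clause ac_simps)
  then show ?case
    by (simp add: add.IH p roof_def)
qed

lemma roof_soften_less_top: "roof (soften \<gamma> G) < top"
  by (induction G) (auto simp: roof_def soften_def top.not_eq_extremum)

lemma cost_soften_finite:
  assumes "cost G X < top"
  shows "cost (soften \<gamma> G) X = cost G X"
  using assms by (induction G) (auto simp: soften_def split: if_splits)

text \<open>A finite sum is infinite only if some summand is, so \<open>X\<close> falsifies a hard
  clause, which weighs \<open>ennreal \<gamma>\<close> after softening.\<close>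

lemma cost_soften_infinite:
  assumes "cost G X = top"
  shows "ennreal \<gamma> \<le> cost (soften \<gamma> G) X"
  using assms
  by (induction G) (auto simp: soften_def add_increasing add_increasing2 split: if_splits)

lemma le_MaxSAT_iff: "r \<le> MaxSAT F \<longleftrightarrow> (\<forall>X. r \<le> cost F X)"
  by (simp add: MaxSAT_def finite_range_cost)

lemma roof_le_MaxSAT_neg_iff:
  assumes "roof G < top"
  shows "roof G \<le> MaxSAT (F + neg_formula G) \<longleftrightarrow> entails F G"
proof -
  have "roof G \<le> cost (F + neg_formula G) X \<longleftrightarrow> cost G X \<le> cost F X" for X
  proof -
    \<comment> \<open>Cancelling this summand in \<open>ennreal\<close> requires it to be finite;
      the roof bounds it.\<close>
    have "cost (neg_formula G) X \<noteq> top"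
      using assms by (auto simp flip: cost_add_cost_neg_formula[of G X])
    then show ?thesis
      by (simp flip: cost_add_cost_neg_formula[of G X]
          add: add.commute[of _ "cost (neg_formula G) X"] ennreal_add_left_cancel_le)
  qed
  then show ?thesis
    by (simp add: le_MaxSAT_iff entails_def)
qed

lemma entails_soften_iff:
  assumes "\<And>X. cost F X < top \<Longrightarrow> cost F X < ennreal \<gamma>"
  shows "entails F (soften \<gamma> G) \<longleftrightarrow> entails F G"
proof -
  have "cost (soften \<gamma> G) X \<le> cost F X \<longleftrightarrow> cost G X \<le> cost F X" for X
  proof (cases "cost F X < top \<and> cost G X = top")
    case True
    then show ?thesis
      using assms[of X] cost_soften_infinite[of G X \<gamma>] by auto
  next
    \<comment> \<open>Either \<open>cost F X\<close> is infinite and both inequalities hold, or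
      softening leaves the cost of \<open>G\<close> at \<open>X\<close> unchanged.\<close>
    case False
    then show ?thesis
      using cost_soften_finite[of G X \<gamma>] by (auto simp: less_top[symmetric])
  qed
  then show ?thesis
    by (simp add: entails_def)
qed

theorem theorem1:
  fixes F G :: "'v wformula" and \<gamma> :: real
  assumes "maxsat_formula F" and "maxsat_formula G"
    and "if \<exists>X. cost F X < \<infinity>
         then ennreal \<gamma> > Max {cost F X | X. cost F X < \<infinity>}
         else \<gamma> > 0"
  shows "entails F G \<longleftrightarrow> MaxSAT (F + neg_formula (soften \<gamma> G)) \<ge> roof (soften \<gamma> G)"
proof -
  have fin: "finite {cost F X | X. cost F X < \<infinity>}"
    by (rule finite_subset[OF _ finite_range_cost[of F]]) auto
  have "cost F X < ennreal \<gamma>" if "cost F X < top" for X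
  proof -
    have "cost F X \<le> Max {cost F X | X. cost F X < \<infinity>}"
      using that by (intro Max_ge[OF fin]) auto
    also have "\<dots> < ennreal \<gamma>"
      using assms(3) that by (auto split: if_splits)
    finally show ?thesis .
  qed
  then show ?thesis
    by (simp add: roof_le_MaxSAT_neg_iff[OF roof_soften_less_top] entails_soften_iff)
qed

end
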